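(* Let $\lambda,\mu,\nu$ be Young diagrams with $\lambda\subset\nu$ and $|\lambda|+|\mu|=|\nu|$. For arbitrary admissible orders $\leqslant_A$ on $\nu\setminus\lambda$ and $\leqslant_{A'}$ on $\mu$, $$\mathbf{P}(\mu,\nu\setminus\lambda)=\mathbf{P}(\mu,\nu\setminus\lambda;A,A').$$
   Context: A Young diagram $\lambda=(\lambda_1\ge\lambda_2\ge\cdots\ge 0)$ is a partition, identified with the set of boxes $(i,j)\in\mathbb{N}\times\mathbb{N}$ (row $i\geq 1$, column $j\geq 1$) with $j\le\lambda_i$; $|\lambda|$ is the number of boxes. For $\lambda\subset\nu$, $\nu\setminus\lambda$ is the set-theoretic difference (a skew diagram). Orders on $X\subset\mathbb{N}\times\mathbb{N}$: $(a,b)\leqslant_P(c,d)$ iff $a\le c$ and $b\le d$ (partial order); $(a,b)\leqslant_J(c,d)$ iff $a<c$, or $a=c$ and $b\ge d$ (total order). A total order $\leqslant_A$ on $X$ is called admissible if for all $(a,b),(c,d)\in X$, $a\le c$ and $b\ge d$ imply $(a,b)\leqslant_A(c,d)$. (The order $\leqslant_J$ is admissible.) For $X,Y\subset\mathbb{N}\times\mathbb{N}$ and an admissible order $\leqslant_A$ on $Y$, a map $f:X\to Y$ is $PA$-standard if $x\leqslant_P x'$ implies $f(x)\leqslant_A f(x')$ for all $x,x'\in X$; it is $PJ$-standard if this holds with $\leqslant_J$ in place of $\leqslant_A$. $\mathbf{P}(\mu,\nu\setminus\lambda)$ is the set of pictures from $\mu$ to $\nu\setminus\lambda$, i.e. bijections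 $f:\mu\to\nu\setminus\lambda$ such that both $f$ and $f^{-1}$ are $PJ$-standard. Given admissible orders $\leqslant_A$ on $\nu\setminus\lambda$ and $\leqslant_{A'}$ on $\mu$, $\mathbf{P}(\mu,\nu\setminus\lambda;A,A')$ is the set of $(A,A')$-admissible pictures, i.e. bijections $f:\mu\to\nu\setminus\lambda$ such that $f$ is $PA$-standard and $f^{-1}:\nu\setminus\lambda\to\mu$ is $PA'$-standard. *)

theory Defs
  imports Complex_Main "HOL-Library.FuncSet"
begin

type_synonym box = "nat \<times> nat"

(* Parts are indexed from 1; the value p 0 plays no role. *)
definition is_partition :: "(nat \<Rightarrow> nat) \<Rightarrow> bool" where
  "is_partition p \<longleftrightarrow>
     (\<forall>i j. 1 \<le> i \<longrightarrow> i \<le> j \<longrightarrow> p j \<le> p i) \<and> finite {i. 1 \<le> i \<and> p i \<noteq> 0}"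

definition boxes :: "(nat \<Rightarrow> nat) \<Rightarrow> box set" where
  "boxes p = {(i, j). 1 \<le> i \<and> 1 \<le> j \<and> j \<le> p i}"

definition young_diagram :: "box set \<Rightarrow> bool" where
  "young_diagram D \<longleftrightarrow> (\<exists>p. is_partition p \<and> D = boxes p)"

(* Orders are relations: (x, y) is a member of r when x is less than or equal to y. *)

definition P_order :: "box rel" where
  "P_order = {((a, b), (c, d)). a \<le> c \<and> b \<le> d}"

definition J_order :: "box rel" where
  "J_order = {((a, b), (c, d)). a < c \<or> (a = c \<and> d \<le> b)}"

definition admissible_order :: "box set \<Rightarrow> box rel \<Rightarrow> bool" where
  "admissible_order X r \<longleftrightarrow> linear_order_on X r \<and>
     (\<forall>a b c d. (a, b) \<in> X \<longrightarrow> (c, d) \<in> X \<longrightarrow> a \<le> c \<longrightarrow> d \<le> b \<longrightarrow> ((a, b), (c, d)) \<in> r)"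

definition PA_standard :: "box set \<Rightarrow> box set \<Rightarrow> box rel \<Rightarrow> (box \<Rightarrow> box) \<Rightarrow> bool" where
  "PA_standard X Y A f \<longleftrightarrow> f \<in> X \<rightarrow> Y \<and>
     (\<forall>x\<in>X. \<forall>x'\<in>X. (x, x') \<in> P_order \<longrightarrow> (f x, f x') \<in> A)"

definition PJ_standard :: "box set \<Rightarrow> box set \<Rightarrow> (box \<Rightarrow> box) \<Rightarrow> bool" where
  "PJ_standard X Y f \<longleftrightarrow> PA_standard X Y J_order f"

(* Maps between sets of boxes are taken extensional (undefined off their domain), so that
   equality of sets of pictures is equality of sets of maps. *)

definition pictures :: "box set \<Rightarrow> box set \<Rightarrow> (box \<Rightarrow> box) set" where
  "pictures X Y = {f \<in> X \<rightarrow>\<^sub>E Y. bij_betw f X Y \<and>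
     PJ_standard X Y f \<and> PJ_standard Y X (inv_into X f)}"

(* A is an order on the codomain Y, A' an order on the domain X. *)
definition admissible_pictures ::
    "box set \<Rightarrow> box set \<Rightarrow> box rel \<Rightarrow> box rel \<Rightarrow> (box \<Rightarrow> box) set" where
  "admissible_pictures X Y A A' = {f \<in> X \<rightarrow>\<^sub>E Y. bij_betw f X Y \<and>
     PA_standard X Y A f \<and> PA_standard Y X A' (inv_into X f)}"

lemma admissible_order_J: "admissible_order X (J_order \<inter> X \<times> X)"
  by (auto simp: admissible_order_def J_order_def order_on_defs refl_on_def
      intro!: transI antisymI total_onI)

lemma finite_young_diagram:
  assumes "young_diagram D"
  shows "finite D"
proof -
  obtain p where p: "finite {i. 1 \<le> i \<and> p i \<noteq> 0}" "D = boxes p"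
    using assms by (auto simp: young_diagram_def is_partition_def)
  have "D \<subseteq> Sigma {i. 1 \<le> i \<and> p i \<noteq> 0} (\<lambda>i. {..p i})"
    using p(2) by (auto simp: boxes_def)
  then show ?thesis
    using p(1) by (meson finite_SigmaI finite_atMost finite_subset)
qed

end

theory Submission
  imports Defs
begin

text \<open>
  Write \<open>Q\<close> for the partial order ``weakly south-west'', which every admissible order extends.
  If \<open>f\<close> is an \<open>(A, A')\<close>-admissible picture with inverse \<open>g\<close>, antisymmetry alone shows that
  \<open>x < x'\<close> for \<open>P\<close> excludes \<open>f x' \<le> f x\<close> for \<open>Q\<close>, and likewise for \<open>g\<close>. These two exclusions no
  longer mention \<open>A\<close> and \<open>A'\<close>, and on convex sets of boxes they imply that both \<open>f\<close> and \<open>g\<close> send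
  \<open>P\<close> to \<open>Q\<close>, hence are standard for all admissible orders.

  The exclusions say that moving down a column moves the image to a strictly lower row, and moving
  right along a row moves the image to a strictly smaller column. If in row \<open>i\<close> the image of a box
  further right were strictly higher, then pulling back the north-east corner of the rectangle
  spanned by the two images would give a row above \<open>i\<close> with the same defect, so infinite
  descent applies. The argument for columns is similar.
\<close>

section \<open>Orders and convexity of skew diagrams\<close>

definition Q_order :: "box rel" where
  "Q_order = {((a, b), (c, d)). a \<le> c \<and> d \<le> b}"

text \<open>Order-convexity for \<open>P_order\<close>. It retains just enough of the shape of a
  skew diagram to complete rectangles, and treats domain and codomain alike.\<close>

definition box_convex :: "box set \<Rightarrow> bool" where
  "box_convex X \<longleftrightarrow>
     (\<forall>x\<in>X. \<forall>z\<in>X. \<forall>y. (x, y) \<in> P_order \<longrightarrow> (y, z) \<in> P_order \<longrightarrow> y \<in> X)"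

lemma P_order_iff: "(x, y) \<in> P_order \<longleftrightarrow> fst x \<le> fst y \<and> snd x \<le> snd y"
  by (auto simp: P_order_def split: prod.splits)

lemma Q_order_iff: "(x, y) \<in> Q_order \<longleftrightarrow> fst x \<le> fst y \<and> snd y \<le> snd x"
  by (auto simp: Q_order_def split: prod.splits)

lemma box_convexD:
  assumes "box_convex X" "(a, b) \<in> X" "(c, d) \<in> X" "a \<le> c" "b \<le> d"
  shows "(a, d) \<in> X" "(c, b) \<in> X"
  using assms unfolding box_convex_def P_order_iff by fastforce+

lemma young_diagram_down_closed:
  assumes "young_diagram D" "(c, d) \<in> D" "1 \<le> a" "a \<le> c" "1 \<le> b" "b \<le> d"
  shows "(a, b) \<in> D"
proof -
  obtain p where p: "is_partition p" "D = boxes p"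
    using assms(1) by (auto simp: young_diagram_def)
  then have "p c \<le> p a"
    using assms by (auto simp: is_partition_def)
  then show ?thesis
    using assms p(2) by (auto simp: boxes_def)
qed

lemma young_diagram_positive:
  assumes "young_diagram D" "(a, b) \<in> D"
  shows "1 \<le> a" "1 \<le> b"
  using assms by (auto simp: young_diagram_def boxes_def)

text \<open>Since \<open>y\<close> is below \<open>z\<close>, it lies in \<open>nu\<close>; were it
  in \<open>lam\<close>, then \<open>x\<close> below it would be in \<open>lam\<close> too.\<close>

lemma box_convex_skew:
  assumes "young_diagram nu" "young_diagram lam"
  shows "box_convex (nu - lam)"
  unfolding box_convex_def P_order_iff
proof (intro ballI allI impI)
  fix x z y :: box
  assume x: "x \<in> nu - lam" and z: "z \<in> nu - lam"
    and "fst x \<le> fst y \<and> snd x \<le> snd y" "fst y \<le> fst z \<and> snd y \<le> snd z"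
  moreover obtain a b c d e h where "x = (a, b)" "y = (c, d)" "z = (e, h)"
    by (metis surj_pair)
  \<comment> \<open>Down-closure covers only indices from 1 on; this bound passes from
    \<open>x\<close> to \<open>y\<close>.\<close>
  moreover have "1 \<le> a" "1 \<le> b"
    using x young_diagram_positive[OF assms(1)] \<open>x = (a, b)\<close> by auto
  ultimately show "y \<in> nu - lam"
    using young_diagram_down_closed[OF assms(1), of e h c d]
      young_diagram_down_closed[OF assms(2), of c d a b] by auto
qed

text \<open>Lets a straight shape be treated as a skew shape.\<close>

lemma young_diagram_empty: "young_diagram {}"
  unfolding young_diagram_def
  by (rule exI[of _ "\<lambda>_. 0"]) (auto simp: is_partition_def boxes_def)

lemma box_convex_young_diagram: "young_diagram D \<Longrightarrow> box_convex D"
  using box_convex_skew[OF _ young_diagram_empty] by simp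

section \<open>Bijections satisfying the two exclusions\<close>

locale weak_picture =
  fixes X Y :: "box set" and f g :: "box \<Rightarrow> box"
  assumes convex_dom: "box_convex X" and convex_cod: "box_convex Y"
    and f_in: "x \<in> X \<Longrightarrow> f x \<in> Y" and g_in: "y \<in> Y \<Longrightarrow> g y \<in> X"
    and g_f: "x \<in> X \<Longrightarrow> g (f x) = x" and f_g: "y \<in> Y \<Longrightarrow> f (g y) = y"
    and f_weak: "\<lbrakk>x \<in> X; x' \<in> X; (x, x') \<in> P_order; (f x', f x) \<in> Q_order\<rbrakk> \<Longrightarrow> x = x'"
    and g_weak: "\<lbrakk>y \<in> Y; y' \<in> Y; (y, y') \<in> P_order; (g y', g y) \<in> Q_order\<rbrakk> \<Longrightarrow> y = y'"
begin

text \<open>The assumptions are symmetric in \<open>f\<close> and \<open>g\<close>, so every fact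
  about \<open>f\<close> transfers to \<open>g\<close>.\<close>

lemma weak_picture_inverse: "weak_picture Y X g f"
  by unfold_locales
    (use convex_dom convex_cod f_in g_in g_f f_g f_weak g_weak in blast)+

text \<open>A failure puts \<open>f x'\<close> weakly north-east or weakly north-west of
  \<open>f x\<close>. The first contradicts \<open>f_weak\<close>; the second contradicts
  \<open>g_weak\<close>, since boxes in one column are comparable for \<open>Q_order\<close> as
  well.\<close>

lemma down_strictly_lower:
  assumes "x \<in> X" "x' \<in> X" "snd x = snd x'" "fst x < fst x'"
  shows "fst (f x) < fst (f x')"
proof (rule ccontr)
  assume "\<not> fst (f x) < fst (f x')"
  then consider "(f x', f x) \<in> Q_order" | "(f x', f x) \<in> P_order"
    unfolding P_order_iff Q_order_iff by linarith
  then show False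
  proof cases
    case 1
    then show False using f_weak[of x x'] assms by (auto simp: P_order_iff)
  next
    case 2
    moreover have "(g (f x), g (f x')) \<in> Q_order"
      using assms g_f by (simp add: Q_order_iff)
    ultimately have "f x' = f x"
      using g_weak f_in assms(1,2) by blast
    then show False using assms g_f by (metis less_irrefl)
  qed
qed

lemma right_strictly_left:
  assumes "x \<in> X" "x' \<in> X" "fst x = fst x'" "snd x < snd x'"
  shows "snd (f x') < snd (f x)"
proof (rule ccontr)
  assume "\<not> snd (f x') < snd (f x)"
  then consider "(f x', f x) \<in> Q_order" | "(f x, f x') \<in> P_order"
    unfolding P_order_iff Q_order_iff by linarith
  then show False
  proof cases
    case 1
    then show False using f_weak[of x x'] assms by (auto simp: P_order_iff)
  next
    case 2
    moreover have "(g (f x'), g (f x)) \<in> Q_order"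
      using assms g_f by (simp add: Q_order_iff)
    ultimately have "f x = f x'"
      using g_weak f_in assms(1,2) by blast
    then show False using assms g_f by (metis less_irrefl)
  qed
qed

lemma right_weakly_lower:
  assumes "(i, j) \<in> X" "(i, j') \<in> X" "j < j'"
  shows "fst (f (i, j)) \<le> fst (f (i, j'))"
  using assms
proof (induction i arbitrary: j j' rule: less_induct)
  case (less i)
  interpret inv: weak_picture Y X g f by (rule weak_picture_inverse)
  show ?case
  proof (rule ccontr)
    assume neg: "\<not> ?thesis"
    obtain a b a' b' where ab: "f (i, j) = (a, b)" and ab': "f (i, j') = (a', b')"
      by (metis surj_pair)
    have Y: "(a, b) \<in> Y" "(a', b') \<in> Y"
      using f_in less.prems ab ab' by metis+
    have g: "g (a, b) = (i, j)" "g (a', b') = (i, j')"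
      using g_f less.prems ab ab' by metis+
    have "a' < a" using neg ab ab' by simp
    have "b' < b"
      using right_strictly_left[of "(i, j)" "(i, j')"] less.prems ab ab' by simp
    have corner: "(a', b) \<in> Y"
      using box_convexD(1)[OF convex_cod Y(2,1)] \<open>a' < a\<close> \<open>b' < b\<close> by simp
    obtain m n where mn: "g (a', b) = (m, n)" by (metis surj_pair)
    \<comment> \<open>Strictness for \<open>g\<close>: the corner is above \<open>(a, b)\<close> in
      its column and to the right of \<open>(a', b')\<close> in its row.\<close>
    have "m < i"
      using inv.down_strictly_lower[OF corner Y(1)] \<open>a' < a\<close> g mn by simp
    have "n < j'"
      using inv.right_strictly_left[OF Y(2) corner] \<open>b' < b\<close> g mn by simp
    have X: "(m, n) \<in> X" using g_in[OF corner] mn by simp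
    \<comment> \<open>The defect recurs in row \<open>m\<close>: \<open>(m, n)\<close> has its image
      in row \<open>a'\<close>, while the box \<open>(m, j')\<close> further right is above
      \<open>(i, j')\<close>, so its image is above row \<open>a'\<close>.\<close>
    have X': "(m, j') \<in> X"
      using box_convexD(1)[OF convex_dom X less.prems(2)] \<open>m < i\<close> \<open>n < j'\<close> by simp
    have "fst (f (m, j')) < a'"
      using down_strictly_lower[OF X' less.prems(2)] \<open>m < i\<close> ab' by simp
    moreover have "fst (f (m, n)) \<le> fst (f (m, j'))"
      by (rule less.IH[OF \<open>m < i\<close> X X' \<open>n < j'\<close>])
    moreover have "f (m, n) = (a', b)" using f_g[OF corner] mn by simp
    ultimately show False by simp
  qed
qed

lemma down_weakly_left:
  assumes "(i, j) \<in> X" "(i', j) \<in> X" "i < i'"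
  shows "snd (f (i', j)) \<le> snd (f (i, j))"
  using assms
proof (induction j arbitrary: i i' rule: less_induct)
  case (less j)
  interpret inv: weak_picture Y X g f by (rule weak_picture_inverse)
  show ?case
  proof (rule ccontr)
    assume neg: "\<not> ?thesis"
    obtain a b a' b' where ab: "f (i, j) = (a, b)" and ab': "f (i', j) = (a', b')"
      by (metis surj_pair)
    have Y: "(a, b) \<in> Y" "(a', b') \<in> Y"
      using f_in less.prems ab ab' by metis+
    have g: "g (a, b) = (i, j)" "g (a', b') = (i', j)"
      using g_f less.prems ab ab' by metis+
    have "b < b'" using neg ab ab' by simp
    have "a < a'"
      using down_strictly_lower[of "(i, j)" "(i', j)"] less.prems ab ab' by simp
    have corner: "(a, b') \<in> Y"
      using box_convexD(1)[OF convex_cod Y] \<open>a < a'\<close> \<open>b < b'\<close> by simp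
    obtain m n where mn: "g (a, b') = (m, n)" by (metis surj_pair)
    have "n < j"
      using inv.right_strictly_left[OF Y(1) corner] \<open>b < b'\<close> g mn by simp
    have "m < i'"
      using inv.down_strictly_lower[OF corner Y(2)] \<open>a < a'\<close> g mn by simp
    have X: "(m, n) \<in> X" using g_in[OF corner] mn by simp
    \<comment> \<open>The defect recurs in column \<open>n\<close>: \<open>(m, n)\<close> has its
      image in column \<open>b'\<close>, while \<open>(i', n)\<close> is left of
      \<open>(i', j)\<close>, so its image is right of column \<open>b'\<close>.\<close>
    have X': "(i', n) \<in> X"
      using box_convexD(2)[OF convex_dom X less.prems(2)] \<open>m < i'\<close> \<open>n < j\<close> by simp
    have "b' < snd (f (i', n))"
      using right_strictly_left[OF X' less.prems(2)] \<open>n < j\<close> ab' by simp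
    moreover have "snd (f (i', n)) \<le> snd (f (m, n))"
      by (rule less.IH[OF \<open>n < j\<close> X X' \<open>m < i'\<close>])
    moreover have "f (m, n) = (a, b')" using f_g[OF corner] mn by simp
    ultimately show False by simp
  qed
qed

lemma P_order_imp_Q_order:
  assumes "x \<in> X" "x' \<in> X" "(x, x') \<in> P_order"
  shows "(f x, f x') \<in> Q_order"
proof -
  obtain a b c d where x: "x = (a, b)" and x': "x' = (c, d)"
    by (metis surj_pair)
  have le: "a \<le> c" "b \<le> d" using assms(3) x x' by (auto simp: P_order_iff)
  \<comment> \<open>Convexity allows a path right along row \<open>a\<close>, then down column
    \<open>d\<close>; each leg goes up in \<open>Q_order\<close>.\<close>
  have X: "(a, d) \<in> X" using box_convexD(1)[OF convex_dom] assms le x x' by blast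
  have "(f (a, b), f (a, d)) \<in> Q_order"
    using right_weakly_lower[of a b d] right_strictly_left[of "(a, b)" "(a, d)"] X assms le x
    by (cases "b = d") (auto simp: Q_order_iff)
  moreover have "(f (a, d), f (c, d)) \<in> Q_order"
    using down_weakly_left[of a d c] down_strictly_lower[of "(a, d)" "(c, d)"] X assms le x'
    by (cases "a = c") (auto simp: Q_order_iff)
  ultimately show ?thesis unfolding x x' Q_order_iff by linarith
qed

end

section \<open>Independence of the chosen orders\<close>

lemma standard_imp_Q_standard:
  assumes "box_convex X" "box_convex Y" "bij_betw f X Y"
    and A: "antisym A" "Q_order \<inter> Y \<times> Y \<subseteq> A"
    and A': "antisym A'" "Q_order \<inter> X \<times> X \<subseteq> A'"
    and f: "PA_standard X Y A f" and g: "PA_standard Y X A' (inv_into X f)"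
  shows "PA_standard X Y Q_order f \<and> PA_standard Y X Q_order (inv_into X f)"
proof -
  let ?g = "inv_into X f"
  have f_in: "f x \<in> Y" if "x \<in> X" for x
    using f that by (auto simp: PA_standard_def)
  have g_in: "?g y \<in> X" if "y \<in> Y" for y
    using g that by (auto simp: PA_standard_def)
  have g_f: "?g (f x) = x" if "x \<in> X" for x
    using bij_betw_inv_into_left[OF assms(3) that] .
  have f_g: "f (?g y) = y" if "y \<in> Y" for y
    using bij_betw_inv_into_right[OF assms(3) that] .
  have f_weak: "x = x'"
    if "x \<in> X" "x' \<in> X" "(x, x') \<in> P_order" "(f x', f x) \<in> Q_order" for x x'
  proof -
    have "(f x, f x') \<in> A" using f that by (auto simp: PA_standard_def)
    moreover have "(f x', f x) \<in> A" using A(2) f_in that by blast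
    ultimately have "f x = f x'" using A(1) by (meson antisymD)
    then show ?thesis using g_f that by metis
  qed
  have g_weak: "y = y'"
    if "y \<in> Y" "y' \<in> Y" "(y, y') \<in> P_order" "(?g y', ?g y) \<in> Q_order" for y y'
  proof -
    have "(?g y, ?g y') \<in> A'" using g that by (auto simp: PA_standard_def)
    moreover have "(?g y', ?g y) \<in> A'" using A'(2) g_in that by blast
    ultimately have "?g y = ?g y'" using A'(1) by (meson antisymD)
    then show ?thesis using f_g that by metis
  qed
  interpret weak_picture X Y f ?g
    by unfold_locales (fact assms f_in g_in g_f f_g f_weak g_weak)+
  interpret inv: weak_picture Y X ?g f by (rule weak_picture_inverse)
  show ?thesis
    using f_in g_in P_order_imp_Q_order inv.P_order_imp_Q_order
    by (auto simp: PA_standard_def)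
qed

lemma PA_standard_mono:
  assumes "PA_standard X Y A f" "A \<inter> Y \<times> Y \<subseteq> B"
  shows "PA_standard X Y B f"
  using assms unfolding PA_standard_def by blast

text \<open>Asking only for antisymmetry and an extension of \<open>Q_order\<close> also covers
  \<open>J_order\<close>, which relates boxes outside the diagrams too. One inclusion is the
  rigidity result, the other is monotonicity in the order.\<close>

lemma admissible_pictures_eq_Q:
  assumes "box_convex X" "box_convex Y"
    and "antisym A" "Q_order \<inter> Y \<times> Y \<subseteq> A" "antisym A'" "Q_order \<inter> X \<times> X \<subseteq> A'"
  shows "admissible_pictures X Y A A' = admissible_pictures X Y Q_order Q_order"
  unfolding admissible_pictures_def
  using standard_imp_Q_standard[OF assms(1,2) _ assms(3-6)]
    PA_standard_mono[OF _ assms(4)] PA_standard_mono[OF _ assms(6)] by blast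

lemma antisym_J_order: "antisym J_order"
  by (auto simp: antisym_def J_order_def)

lemma Q_order_subset_J_order: "Q_order \<subseteq> J_order"
  by (auto simp: Q_order_def J_order_def)

lemma admissible_order_antisym: "admissible_order X A \<Longrightarrow> antisym A"
  by (auto simp: admissible_order_def order_on_defs)

lemma admissible_order_extends_Q: "admissible_order X A \<Longrightarrow> Q_order \<inter> X \<times> X \<subseteq> A"
  by (auto simp: admissible_order_def Q_order_def)

lemma pictures_eq_admissible: "pictures X Y = admissible_pictures X Y J_order J_order"
  by (simp add: pictures_def admissible_pictures_def PJ_standard_def)

theorem corollary1p2:
  fixes lam mu nu :: "box set" and A A' :: "box rel"
  assumes "young_diagram lam" and "young_diagram mu" and "young_diagram nu"
    and "lam \<subseteq> nu"
    and "card lam + card mu = card nu"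
    and "admissible_order (nu - lam) A"
    and "admissible_order mu A'"
  shows "pictures mu (nu - lam) = admissible_pictures mu (nu - lam) A A'"
proof -
  have convex: "box_convex mu" "box_convex (nu - lam)"
    using assms box_convex_young_diagram box_convex_skew by auto
  \<comment> \<open>The pictures for \<open>Q_order\<close> on both sides depend on no chosen order
    and serve as the middle term.\<close>
  have "pictures mu (nu - lam) = admissible_pictures mu (nu - lam) Q_order Q_order"
    unfolding pictures_eq_admissible
    using Q_order_subset_J_order
    by (intro admissible_pictures_eq_Q convex antisym_J_order) auto
  also have "\<dots> = admissible_pictures mu (nu - lam) A A'"
    using assms(6,7)
    by (intro admissible_pictures_eq_Q[symmetric] convex admissible_order_antisym
        admissible_order_extends_Q)
  finally show ?thesis .
qed

end
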